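(* Let $\eta>0$, and let $M$, $K$, $m$ be the mass matrix, stiffness matrix and mean-value vector of the piecewise linear finite element space described in the context, with $\bar K = K + mm^T$. Then $$\kappa\left(\begin{pmatrix} \bar K + \eta^{-1/2}M & 0\\ 0 & \eta \bar K + \eta^{1/2} M\end{pmatrix}^{-1}\begin{pmatrix} \bar K & M\\ M & -\eta \bar K\end{pmatrix}\right) < \sqrt{2}.$$
   Context: Let $\Omega=(0,1)\times(0,1)$, let $\mathcal{T}_h$ be a triangulation of $\Omega$ with node set $\mathcal{N}_h$, $n=|\mathcal{N}_h|$, and let $(\lambda_p)_{p\in\mathcal{N}_h}$ be the nodal basis of the space of continuous functions on $\bar\Omega$ that are linear on each triangle (no boundary conditions imposed). The mass matrix is $M=(\int_\Omega \lambda_p\lambda_q\,dx)_{p,q}$, the stiffness matrix is $K=(\int_\Omega \nabla\lambda_p\cdot\nabla\lambda_q\,dx)_{p,q}$, and $m=(\int_\Omega\lambda_p\,dx)_p\in\mathbb{R}^n$. The parameter is $\eta=\epsilon\tau>0$, with $\epsilon>0$ the interface parameter and $\tau>0$ the time step. For a nonsingular matrix $Z$ with real eigenvalues (possibly negative), the condition number is $\kappa(Z)=\max|\lambda(Z)|/\min|\lambda(Z)|$, the maximum and minimum being over all eigenvalues $\lambda(Z)$ of $Z$. *)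

theory Defs
  imports "HOL-Analysis.Analysis"
    "Jordan_Normal_Form.Gauss_Jordan_Elimination"
    "Jordan_Normal_Form.Spectral_Radius"
begin

section \<open>Piecewise linear finite elements on the unit square\<close>

type_synonym point = "real \<times> real"

definition unit_square :: "point set" where
  "unit_square = {0<..<1} \<times> {0<..<1}"

text \<open>The library predicate \<^const>\<open>triangulation\<close> requires finitely many closed simplices (of any
  dimension), any two of which meet in a common, possibly empty, face.\<close>

definition square_triangulation :: "point set set \<Rightarrow> bool" where
  "square_triangulation \<T> \<longleftrightarrow>
     triangulation \<T> \<and> (\<forall>T\<in>\<T>. 2 simplex T) \<and> \<Union>\<T> = closure unit_square"

definition mesh_nodes :: "point set set \<Rightarrow> point set" where
  "mesh_nodes \<T> = {p. \<exists>T\<in>\<T>. p extreme_point_of T}"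

text \<open>Functions on the closed square are represented by total functions; their values outside the
  closed square are unconstrained and never used.\<close>

definition fe_space :: "point set set \<Rightarrow> (point \<Rightarrow> real) set" where
  "fe_space \<T> = {u. continuous_on (closure unit_square) u \<and>
                    (\<forall>T\<in>\<T>. \<exists>a b. \<forall>x\<in>T. u x = inner a x + b)}"

definition nodal_basis :: "point set set \<Rightarrow> (point \<Rightarrow> point \<Rightarrow> real) \<Rightarrow> bool" where
  "nodal_basis \<T> \<phi> \<longleftrightarrow>
     (\<forall>p\<in>mesh_nodes \<T>. \<phi> p \<in> fe_space \<T> \<and>
        (\<forall>q\<in>mesh_nodes \<T>. \<phi> p q = (if p = q then 1 else 0)))"

text \<open>The gradient of a finite element function exists off the edges of the mesh; on this null set
  \<open>gradient\<close> may be an unspecified vector, which does not affect the integrals below.\<close>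

definition gradient :: "(point \<Rightarrow> real) \<Rightarrow> point \<Rightarrow> point" where
  "gradient u x = (THE D. GDERIV u x :> D)"

text \<open>The list \<open>ps\<close> is an enumeration of the nodes; it fixes the order of rows and columns.\<close>

definition mass_matrix :: "(point \<Rightarrow> point \<Rightarrow> real) \<Rightarrow> point list \<Rightarrow> real mat" where
  "mass_matrix \<phi> ps = Matrix.mat (length ps) (length ps)
     (\<lambda>(i, j). LINT x:unit_square|lebesgue. \<phi> (ps ! i) x * \<phi> (ps ! j) x)"

definition stiffness_matrix :: "(point \<Rightarrow> point \<Rightarrow> real) \<Rightarrow> point list \<Rightarrow> real mat" where
  "stiffness_matrix \<phi> ps = Matrix.mat (length ps) (length ps)
     (\<lambda>(i, j). LINT x:unit_square|lebesgue.
        inner (gradient (\<phi> (ps ! i)) x) (gradient (\<phi> (ps ! j)) x))"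

definition mean_vector :: "(point \<Rightarrow> point \<Rightarrow> real) \<Rightarrow> point list \<Rightarrow> real Matrix.vec" where
  "mean_vector \<phi> ps = Matrix.vec (length ps)
     (\<lambda>i. LINT x:unit_square|lebesgue. \<phi> (ps ! i) x)"

section \<open>Matrices\<close>

definition outer_square :: "real Matrix.vec \<Rightarrow> real mat" where
  "outer_square v = mat_of_cols (dim_vec v) [v] * mat_of_rows (dim_vec v) [v]"

text \<open>Eigenvalues are taken over the complex numbers, so that none is overlooked.\<close>

definition complex_spectrum :: "real mat \<Rightarrow> complex set" where
  "complex_spectrum Z = spectrum (map_mat complex_of_real Z)"

definition condition_number :: "real mat \<Rightarrow> real" where
  "condition_number Z = Max (cmod ` complex_spectrum Z) / Min (cmod ` complex_spectrum Z)"

text \<open>Meaningful for invertible matrices only.\<close>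

definition matrix_inverse :: "real mat \<Rightarrow> real mat" where
  "matrix_inverse A = the (mat_inverse A)"

end

theory Submission
  imports Defs
begin

text \<open>
  Write \<open>H\<close> for the stiffness matrix with the mean-value correction and \<open>N = \<eta>\<^sup>-\<^sup>1\<^sup>/\<^sup>2 M\<close>.
  Scaling the second block of unknowns, \<open>z = \<eta>\<^sup>1\<^sup>/\<^sup>2 y\<close>, turns the generalized eigenvalue problem of the
  saddle point matrix and its preconditioner into one without a parameter:
  \<open>H x + N z = r G x\<close> and \<open>N x - H z = r G z\<close> with \<open>G = H + N\<close>. Both \<open>H\<close> and \<open>N\<close> are symmetric
  positive definite, so every eigenvalue \<open>r\<close> is real
  (\<open>complex_spectrum_spd_pencil\<close>). Simultaneous diagonalization of \<open>H\<close> and \<open>N\<close>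
  shows what to expect: if \<open>s\<close> is an eigenvalue of \<open>G\<^sup>-\<^sup>1 H\<close>, then \<open>0 < s < 1\<close> and
  \<open>r\<^sup>2 = s\<^sup>2 + (1 - s)\<^sup>2\<close>, whence \<open>1/2 \<le> r\<^sup>2 < 1\<close>. As there are finitely many eigenvalues, the strict
  upper bound makes the quotient of the extreme ones strictly less than \<open>\<surd>2\<close>.

  The proof gets the two bounds by testing the eigenvalue equations instead of diagonalizing
  (\<open>saddle_point_eigenvalue_bounds\<close>). Testing with \<open>(x, z)\<close> itself gives \<open>\<bar>r\<bar> < 1\<close>, since the \<open>G\<close>-form plus
  or minus the saddle point form is a sum of nonnegative terms that vanish together only at zero.
  Testing with \<open>(x + z, x - z)\<close> is an inf-sup argument: the saddle point form then equals the
  squared \<open>G\<close>-norm of \<open>(x, z)\<close>, and the test vector is in this norm longer than \<open>(x, z)\<close> by exactly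
  the factor \<open>\<surd>2\<close>, so \<open>1 \<le> \<surd>2 \<bar>r\<bar>\<close>.

  What remains is the positive definiteness of the two finite element matrices
  (\<open>mass_matrix_spd\<close>, \<open>stiffness_matrix_plus_mean_spd\<close>). For a coefficient
  vector \<open>v\<close> with finite element function \<open>u\<close>, the mass form is \<open>\<integral> u\<^sup>2\<close> and the corrected stiffness form
  is \<open>\<integral> \<bar>\<nabla>u\<bar>\<^sup>2 + (\<integral> u)\<^sup>2\<close>. If the former vanishes, so does \<open>u\<close> by continuity. If the latter vanishes,
  then \<open>u\<close> is constant on each triangle, hence takes finitely many values, hence is constant on
  the connected square, and a constant of mean zero is zero. In both cases the nodal values, which
  are the entries of \<open>v\<close>, vanish.
\<close>

section \<open>Symmetric positive definite matrices\<close>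

unbundle no inner_syntax and no vec_syntax

definition spd_mat :: "nat \<Rightarrow> real mat \<Rightarrow> bool" where
  "spd_mat n A \<longleftrightarrow> A \<in> carrier_mat n n \<and> transpose_mat A = A \<and>
     (\<forall>v\<in>carrier_vec n. v \<noteq> 0\<^sub>v n \<longrightarrow> v \<bullet> (A *\<^sub>v v) > 0)"

lemma spd_matD:
  assumes "spd_mat n A"
  shows "A \<in> carrier_mat n n" "transpose_mat A = A"
    "\<And>v. v \<in> carrier_vec n \<Longrightarrow> v \<noteq> 0\<^sub>v n \<Longrightarrow> v \<bullet> (A *\<^sub>v v) > 0"
    "\<And>v. v \<in> carrier_vec n \<Longrightarrow> v \<bullet> (A *\<^sub>v v) \<ge> 0"
proof -
  show A: "A \<in> carrier_mat n n" and "transpose_mat A = A"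
    and pos: "\<And>v. v \<in> carrier_vec n \<Longrightarrow> v \<noteq> 0\<^sub>v n \<Longrightarrow> v \<bullet> (A *\<^sub>v v) > 0"
    using assms by (auto simp: spd_mat_def)
  fix v :: "real Matrix.vec"
  assume "v \<in> carrier_vec n"
  with pos[of v] A show "v \<bullet> (A *\<^sub>v v) \<ge> 0"
    by (cases "v = 0\<^sub>v n") auto
qed

lemma smult_mat_mult_vec:
  fixes A :: "'a :: comm_semiring_0 mat"
  assumes "A \<in> carrier_mat nr nc" "v \<in> carrier_vec nc"
  shows "(c \<cdot>\<^sub>m A) *\<^sub>v v = c \<cdot>\<^sub>v (A *\<^sub>v v)"
  using assms by (intro eq_vecI) (auto simp: scalar_prod_def sum_distrib_left mult.assoc)

lemma symmetric_form_commute: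
  fixes A :: "'a :: comm_semiring_0 mat"
  assumes "A \<in> carrier_mat n n" "transpose_mat A = A" "x \<in> carrier_vec n" "y \<in> carrier_vec n"
  shows "x \<bullet> (A *\<^sub>v y) = y \<bullet> (A *\<^sub>v x)"
proof -
  have "x \<bullet> (A *\<^sub>v y) = (A *\<^sub>v x) \<bullet> y"
    using transpose_vec_mult_scalar[OF assms(1) assms(4) assms(3)] assms(2) by simp
  also have "\<dots> = y \<bullet> (A *\<^sub>v x)"
    by (rule comm_scalar_prod[of _ n]) (use assms in auto)
  finally show ?thesis .
qed

lemma spd_mat_add:
  assumes A: "spd_mat n A" and B: "spd_mat n B"
  shows "spd_mat n (A + B)"
proof -
  note a = spd_matD[OF A] and b = spd_matD[OF B]
  have "v \<bullet> ((A + B) *\<^sub>v v) > 0" if v: "v \<in> carrier_vec n" "v \<noteq> 0\<^sub>v n" for v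
  proof -
    have "v \<bullet> ((A + B) *\<^sub>v v) = v \<bullet> (A *\<^sub>v v) + v \<bullet> (B *\<^sub>v v)"
      using a(1) b(1) v by (simp add: add_mult_distrib_mat_vec[of _ n n] scalar_prod_add_distrib[of _ n])
    with a(3)[OF v] b(3)[OF v] show ?thesis by simp
  qed
  moreover have "transpose_mat (A + B) = A + B"
    using a(1,2) b(1,2) by (simp add: transpose_add[of _ n n])
  ultimately show ?thesis
    using a(1) b(1) by (auto simp: spd_mat_def)
qed

lemma spd_mat_smult:
  assumes A: "spd_mat n A" and "c > 0"
  shows "spd_mat n (c \<cdot>\<^sub>m A)"
proof -
  note a = spd_matD[OF A]
  have "v \<bullet> ((c \<cdot>\<^sub>m A) *\<^sub>v v) > 0" if v: "v \<in> carrier_vec n" "v \<noteq> 0\<^sub>v n" for v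
    using a(1) a(3)[OF v] v \<open>c > 0\<close> by (simp add: smult_mat_mult_vec[of _ n n])
  moreover have "transpose_mat (c \<cdot>\<^sub>m A) = c \<cdot>\<^sub>m A"
    using a(1) arg_cong[OF a(2), of "(\<cdot>\<^sub>m) c"] by (auto simp: mat_eq_iff)
  ultimately show ?thesis
    using a(1) by (auto simp: spd_mat_def)
qed

lemma append_vec_eq_zero_iff:
  assumes "x \<in> carrier_vec n" "y \<in> carrier_vec m"
  shows "x @\<^sub>v y = 0\<^sub>v (n + m) \<longleftrightarrow> x = 0\<^sub>v n \<and> y = 0\<^sub>v m"
proof -
  have "0\<^sub>v (n + m) = 0\<^sub>v n @\<^sub>v (0\<^sub>v m :: 'a Matrix.vec)"
    by (intro eq_vecI) auto
  then show ?thesis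
    using assms by (auto simp: append_vec_eq[of _ n])
qed

lemma spd_mat_block_diag:
  assumes A: "spd_mat n A" and B: "spd_mat m B"
  shows "spd_mat (n + m) (four_block_mat A (0\<^sub>m n m) (0\<^sub>m m n) B)" (is "spd_mat _ ?D")
proof -
  note a = spd_matD[OF A] and b = spd_matD[OF B]
  have "v \<bullet> (?D *\<^sub>v v) > 0" if v: "v \<in> carrier_vec (n + m)" "v \<noteq> 0\<^sub>v (n + m)" for v
  proof -
    define x where "x = vec_first v n"
    define y where "y = vec_last v m"
    have xy: "v = x @\<^sub>v y" "x \<in> carrier_vec n" "y \<in> carrier_vec m"
      using v(1) by (simp_all add: x_def y_def)
    have "v \<bullet> (?D *\<^sub>v v) = x \<bullet> (A *\<^sub>v x) + y \<bullet> (B *\<^sub>v y)"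
      unfolding xy(1) mult_mat_vec_split[OF a(1) b(1) xy(2,3)]
      by (rule scalar_prod_append) (use xy a(1) b(1) in auto)
    moreover have "x \<noteq> 0\<^sub>v n \<or> y \<noteq> 0\<^sub>v m"
      using v(2) xy append_vec_eq_zero_iff by blast
    ultimately show ?thesis
      using a(3,4)[OF xy(2)] b(3,4)[OF xy(3)] by fastforce
  qed
  moreover have "transpose_mat ?D = ?D"
    using a(1,2) b(1,2) by (simp add: transpose_four_block_mat[of _ n n _ m _ m])
  ultimately show ?thesis
    using a(1) b(1) by (auto simp: spd_mat_def)
qed

lemma invertible_mat_if_det_nonzero:
  fixes A :: "'a :: field mat"
  assumes A: "A \<in> carrier_mat n n" and "Determinant.det A \<noteq> 0"
  shows "invertible_mat A"
proof -
  obtain B where "A * B = 1\<^sub>m n" "B * A = 1\<^sub>m n" "B \<in> carrier_mat n n"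
    using det_non_zero_imp_unit[OF assms, of "()"]
    by (auto simp: Units_def ring_mat_def)
  then show ?thesis
    using A unfolding invertible_mat_def inverts_mat_def by auto
qed

lemma spd_mat_det_nonzero:
  assumes "spd_mat n A"
  shows "Determinant.det A \<noteq> 0"
proof
  note a = spd_matD[OF assms]
  assume "Determinant.det A = 0"
  then obtain v where "v \<in> carrier_vec n" "v \<noteq> 0\<^sub>v n" "A *\<^sub>v v = 0\<^sub>v n"
    using det_0_iff_vec_prod_zero[OF a(1)] by blast
  with a(3)[of v] show False by simp
qed

lemma matrix_inverse_inverts:
  assumes A: "A \<in> carrier_mat n n" and det: "Determinant.det A \<noteq> 0"
  shows "A * matrix_inverse A = 1\<^sub>m n" "matrix_inverse A * A = 1\<^sub>m n"
    "matrix_inverse A \<in> carrier_mat n n"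
proof -
  have "mat_inverse A \<noteq> None"
    using mat_inverse(1)[OF A, of "()"] det_non_zero_imp_unit[OF A det, of "()"] by blast
  then have "mat_inverse A = Some (matrix_inverse A)"
    by (simp add: matrix_inverse_def)
  from mat_inverse(2)[OF A this]
  show "A * matrix_inverse A = 1\<^sub>m n" "matrix_inverse A * A = 1\<^sub>m n"
    "matrix_inverse A \<in> carrier_mat n n" by auto
qed

section \<open>Eigenvalues of symmetric definite pencils\<close>

lemma mult_mat_vec_Re_Im:
  fixes A :: "real mat" and w :: "complex Matrix.vec"
  assumes A: "A \<in> carrier_mat nr nc" and w: "w \<in> carrier_vec nc"
  shows "map_vec Re (map_mat complex_of_real A *\<^sub>v w) = A *\<^sub>v map_vec Re w"
    and "map_vec Im (map_mat complex_of_real A *\<^sub>v w) = A *\<^sub>v map_vec Im w"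
  using assms by (auto intro!: eq_vecI simp: scalar_prod_def)

text \<open>
  The matrix \<open>P\<^sup>-\<^sup>1 A\<close> is self-adjoint for the inner product of \<open>P\<close>. For a complex eigenvector \<open>x + \<i> y\<close>
  with eigenvalue \<open>a + \<i> b\<close>, the symmetry of the \<open>A\<close>-form on \<open>x\<close> and \<open>y\<close> becomes
  \<open>b (x\<^sup>T P x + y\<^sup>T P y) = 0\<close>. So \<open>b = 0\<close>, and then the real and the imaginary part both solve the
  eigenvalue equation; one of them is nonzero.
\<close>

lemma complex_spectrum_spd_pencil:
  assumes P: "spd_mat n P" and A: "A \<in> carrier_mat n n" and sym: "transpose_mat A = A"
    and k: "k \<in> complex_spectrum (matrix_inverse P * A)"
  obtains r v where "k = complex_of_real r" "v \<in> carrier_vec n" "v \<noteq> 0\<^sub>v n"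
    "A *\<^sub>v v = r \<cdot>\<^sub>v (P *\<^sub>v v)"
proof -
  note p = spd_matD[OF P]
  note inv = matrix_inverse_inverts[OF p(1) spd_mat_det_nonzero[OF P]]
  let ?Z = "matrix_inverse P * A"
  have Z: "?Z \<in> carrier_mat n n" using inv(3) A by simp
  obtain w where w: "w \<in> carrier_vec n" "w \<noteq> 0\<^sub>v n"
    and ev: "map_mat complex_of_real ?Z *\<^sub>v w = k \<cdot>\<^sub>v w"
    using k Z inv(3) unfolding complex_spectrum_def spectrum_def eigenvalue_def eigenvector_def by auto
  define x where "x = map_vec Re w"
  define y where "y = map_vec Im w"
  define a where "a = Re k"
  define b where "b = Im k"
  have x: "x \<in> carrier_vec n" and y: "y \<in> carrier_vec n"
    using w(1) by (auto simp: x_def y_def)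
  have "?Z *\<^sub>v x = map_vec Re (k \<cdot>\<^sub>v w)" "?Z *\<^sub>v y = map_vec Im (k \<cdot>\<^sub>v w)"
    using mult_mat_vec_Re_Im[OF Z w(1)] ev by (simp_all add: x_def y_def)
  then have Zx: "?Z *\<^sub>v x = a \<cdot>\<^sub>v x + (- b) \<cdot>\<^sub>v y" and Zy: "?Z *\<^sub>v y = b \<cdot>\<^sub>v x + a \<cdot>\<^sub>v y"
    using w(1) by (auto simp: x_def y_def a_def b_def intro!: eq_vecI)
  have PZ: "P *\<^sub>v (?Z *\<^sub>v u) = A *\<^sub>v u" if "u \<in> carrier_vec n" for u
  proof -
    have "P *\<^sub>v (?Z *\<^sub>v u) = (P * matrix_inverse P) *\<^sub>v (A *\<^sub>v u)"
      using p(1) inv(3) A that by (simp add: assoc_mult_mat_vec[of _ n n _ n] del: inv(1))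
    then show ?thesis using inv(1) A that by simp
  qed
  have Ax: "A *\<^sub>v x = a \<cdot>\<^sub>v (P *\<^sub>v x) + (- b) \<cdot>\<^sub>v (P *\<^sub>v y)"
    unfolding PZ[OF x, symmetric] Zx using p(1) x y
    by (simp add: mult_add_distrib_mat_vec[of _ n n] mult_mat_vec[of _ n n])
  have Ay: "A *\<^sub>v y = b \<cdot>\<^sub>v (P *\<^sub>v x) + a \<cdot>\<^sub>v (P *\<^sub>v y)"
    unfolding PZ[OF y, symmetric] Zy using p(1) x y
    by (simp add: mult_add_distrib_mat_vec[of _ n n] mult_mat_vec[of _ n n])
  have ne: "x \<noteq> 0\<^sub>v n \<or> y \<noteq> 0\<^sub>v n"
  proof (rule ccontr)
    assume "\<not> ?thesis"
    then have "Re (w $ i) = 0" "Im (w $ i) = 0" if "i < n" for i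
      using that w(1) unfolding x_def y_def by (metis index_map_vec(1) carrier_vecD index_zero_vec(1))+
    then have "w = 0\<^sub>v n" using w(1) by (auto intro!: eq_vecI simp: complex_eq_iff)
    with w(2) show False ..
  qed
  have "y \<bullet> (A *\<^sub>v x) = a * (y \<bullet> (P *\<^sub>v x)) - b * (y \<bullet> (P *\<^sub>v y))"
    unfolding Ax using p(1) x y by (simp add: scalar_prod_add_distrib[of _ n])
  moreover have "x \<bullet> (A *\<^sub>v y) = b * (x \<bullet> (P *\<^sub>v x)) + a * (x \<bullet> (P *\<^sub>v y))"
    unfolding Ay using p(1) x y by (simp add: scalar_prod_add_distrib[of _ n])
  ultimately have "b * (x \<bullet> (P *\<^sub>v x) + y \<bullet> (P *\<^sub>v y)) = 0"
    using symmetric_form_commute[OF A sym x y] symmetric_form_commute[OF p(1,2) x y]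
    by (simp add: algebra_simps)
  moreover have "x \<bullet> (P *\<^sub>v x) + y \<bullet> (P *\<^sub>v y) > 0"
    using ne p(3,4)[OF x] p(3,4)[OF y] by fastforce
  ultimately have b: "b = 0" by simp
  have "k = complex_of_real a"
    using b by (simp add: complex_eq_iff a_def b_def)
  moreover have "A *\<^sub>v x = a \<cdot>\<^sub>v (P *\<^sub>v x)" "A *\<^sub>v y = a \<cdot>\<^sub>v (P *\<^sub>v y)"
    using Ax Ay b p(1) x y by (auto intro!: eq_vecI)
  ultimately show thesis
    using ne x y that by blast
qed

text \<open>
  The maximum and the minimum are attained, because the spectrum is finite and, for \<open>n > 0\<close>,
  nonempty. This is why a strict pointwise bound stays strict.
\<close>

lemma condition_number_lt:
  assumes Z: "Z \<in> carrier_mat n n" and "n > 0" and "c > 0"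
    and bounds: "\<And>k. k \<in> complex_spectrum Z \<Longrightarrow> c \<le> cmod k \<and> cmod k < d"
  shows "invertible_mat Z" "condition_number Z < d / c"
proof -
  let ?S = "cmod ` complex_spectrum Z"
  have ZC: "map_mat complex_of_real Z \<in> carrier_mat n n" using Z by simp
  have fin: "finite ?S" and ne: "?S \<noteq> {}"
    using card_finite_spectrum(1)[OF ZC] spectrum_non_empty[OF ZC \<open>n > 0\<close>]
    by (auto simp: complex_spectrum_def)
  have "Min ?S \<ge> c" "Max ?S < d"
    using fin ne bounds by auto
  then show "condition_number Z < d / c"
    unfolding condition_number_def using \<open>c > 0\<close> Max_in[OF fin ne]
    by (intro frac_less) auto
  have "Determinant.det Z \<noteq> 0"
  proof
    assume "Determinant.det Z = 0"
    then obtain v where v: "v \<in> carrier_vec n" "v \<noteq> 0\<^sub>v n" "Z *\<^sub>v v = 0\<^sub>v n"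
      using det_0_iff_vec_prod_zero[OF Z] by blast
    let ?w = "map_vec complex_of_real v"
    have "map_mat complex_of_real Z *\<^sub>v ?w = map_vec complex_of_real (Z *\<^sub>v v)"
      using Z v(1) by (auto intro!: eq_vecI simp: scalar_prod_def)
    then have "eigenvector (map_mat complex_of_real Z) ?w 0"
      unfolding eigenvector_def using v Z by (auto intro!: eq_vecI)
    then have "0 \<in> complex_spectrum Z"
      by (auto simp: complex_spectrum_def spectrum_def eigenvalue_def)
    with bounds[of 0] \<open>c > 0\<close> show False by simp
  qed
  with Z show "invertible_mat Z" by (rule invertible_mat_if_det_nonzero)
qed

section \<open>The preconditioned saddle point matrix\<close>

text \<open>
  The eigenvalue equations are taken in weak form, since only test vectors in the span of \<open>x\<close> and
  \<open>z\<close> matter. The whole argument then takes place among six numbers, the values of the two forms on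
  \<open>x\<close> and \<open>z\<close>, with positivity of the forms on combinations of \<open>x\<close> and \<open>z\<close>. In the comments inside
  the proof, \<open>h\<close> and \<open>n\<close> are the quadratic forms of \<open>H\<close> and \<open>N\<close>, and \<open>G = H + N\<close>; the number \<open>E\<close> is the
  squared \<open>G\<close>-norm of \<open>(x, z)\<close>.
\<close>

lemma saddle_point_eigenvalue_bounds:
  assumes H: "spd_mat n H" and N: "spd_mat n N"
    and x: "x \<in> carrier_vec n" and z: "z \<in> carrier_vec n"
    and ne: "x \<noteq> 0\<^sub>v n \<or> z \<noteq> 0\<^sub>v n"
    and eq1: "\<And>w. w \<in> carrier_vec n \<Longrightarrow>
      w \<bullet> (H *\<^sub>v x) + w \<bullet> (N *\<^sub>v z) = r * (w \<bullet> (H *\<^sub>v x) + w \<bullet> (N *\<^sub>v x))"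
    and eq2: "\<And>w. w \<in> carrier_vec n \<Longrightarrow>
      w \<bullet> (N *\<^sub>v x) - w \<bullet> (H *\<^sub>v z) = r * (w \<bullet> (H *\<^sub>v z) + w \<bullet> (N *\<^sub>v z))"
  shows "1 \<le> sqrt 2 * \<bar>r\<bar>" "\<bar>r\<bar> < 1"
proof -
  note h = spd_matD[OF H] and n = spd_matD[OF N]
  define hxx hxz hzz where "hxx = x \<bullet> (H *\<^sub>v x)" and "hxz = x \<bullet> (H *\<^sub>v z)" and "hzz = z \<bullet> (H *\<^sub>v z)"
  define nxx nxz nzz where "nxx = x \<bullet> (N *\<^sub>v x)" and "nxz = x \<bullet> (N *\<^sub>v z)" and "nzz = z \<bullet> (N *\<^sub>v z)"
  note defs = hxx_def hxz_def hzz_def nxx_def nxz_def nzz_def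
  have hzx: "z \<bullet> (H *\<^sub>v x) = hxz" and nzx: "z \<bullet> (N *\<^sub>v x) = nxz"
    unfolding defs using symmetric_form_commute h(1,2) n(1,2) x z by blast+
  have form: "(s \<cdot>\<^sub>v x + t \<cdot>\<^sub>v z) \<bullet> (B *\<^sub>v (s \<cdot>\<^sub>v x + t \<cdot>\<^sub>v z)) =
      s\<^sup>2 * (x \<bullet> (B *\<^sub>v x)) + s * t * (x \<bullet> (B *\<^sub>v z) + z \<bullet> (B *\<^sub>v x)) + t\<^sup>2 * (z \<bullet> (B *\<^sub>v z))"
    if "B \<in> carrier_mat n n" for B and s t :: real
    using that x z
    by (simp add: mult_add_distrib_mat_vec[of _ n n] mult_mat_vec[of _ n n] scalar_prod_add_distrib[of _ n]
      add_scalar_prod_distrib[of _ n] power2_eq_square algebra_simps)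
  have h_form: "0 \<le> s\<^sup>2 * hxx + 2 * s * t * hxz + t\<^sup>2 * hzz"
    and n_form: "0 \<le> s\<^sup>2 * nxx + 2 * s * t * nxz + t\<^sup>2 * nzz" for s t
    using h(4)[of "s \<cdot>\<^sub>v x + t \<cdot>\<^sub>v z"] n(4)[of "s \<cdot>\<^sub>v x + t \<cdot>\<^sub>v z"] form[OF h(1), of s t] form[OF n(1), of s t] x z
    by (simp_all add: hzx nzx flip: defs)
  have e1x: "hxx + nxz = r * (hxx + nxx)" and e1z: "hxz + nzz = r * (hxz + nxz)"
    and e2x: "nxx - hxz = r * (hxz + nxz)" and e2z: "nxz - hzz = r * (hzz + nzz)"
    using eq1[OF x] eq1[OF z] eq2[OF x] eq2[OF z] by (simp_all add: hzx nzx flip: defs)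
  have pos: "hxx > 0 \<and> nxx > 0 \<or> x = 0\<^sub>v n" "hzz > 0 \<and> nzz > 0 \<or> z = 0\<^sub>v n"
    using h(3)[OF x] h(3)[OF z] n(3)[OF x] n(3)[OF z] by (auto simp: defs)
  have x0: "hxx = 0 \<and> nxx = 0 \<and> hxz = 0 \<and> nxz = 0" if "x = 0\<^sub>v n"
    using that h(1) n(1) z by (simp add: defs)
  have z0: "hzz = 0 \<and> nzz = 0 \<and> hxz = 0 \<and> nxz = 0" if "z = 0\<^sub>v n"
    using that h(1) n(1) x by (simp add: hzz_def nzz_def flip: hzx nzx)
  define E where "E = hxx + nxx + hzz + nzz"
  have E: "E > 0"
    using pos x0 z0 ne by (fastforce simp: E_def)
  \<comment> \<open>Test with \<open>(x, z)\<close>: \<open>E\<close> minus the saddle point form is \<open>n(x - z) + 2 h(z)\<close>.\<close>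
  have "(1 - r) * E = (nxx - 2 * nxz + nzz) + 2 * hzz"
    using e1x e2z by (simp add: E_def algebra_simps)
  moreover have "\<dots> > 0"
    using n_form[of 1 "-1"] pos z0 x0 ne by (cases "z = 0\<^sub>v n") auto
  ultimately have "r < 1"
    using E by (metis diff_gt_0_iff_gt zero_less_mult_pos2)
  \<comment> \<open>\<open>E\<close> plus the saddle point form is \<open>n(x + z) + 2 h(x)\<close>.\<close>
  have "(1 + r) * E = (nxx + 2 * nxz + nzz) + 2 * hxx"
    using e1x e2z by (simp add: E_def algebra_simps)
  moreover have "\<dots> > 0"
    using n_form[of 1 1] pos z0 x0 ne by (cases "x = 0\<^sub>v n") auto
  ultimately have "- r < 1"
    using E by (smt (verit) zero_less_mult_pos2)
  with \<open>r < 1\<close> show "\<bar>r\<bar> < 1" by simp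
  \<comment> \<open>Test with \<open>(x + z, x - z)\<close>: the saddle point form is \<open>E\<close>, and \<open>F\<close> is the \<open>G\<close>-inner product of
    \<open>(x, z)\<close> with the test vector.\<close>
  define F where "F = (hxx + nxx) + 2 * (hxz + nxz) - (hzz + nzz)"
  have EF: "E = r * F"
    using e1x e1z e2x e2z by (simp add: E_def F_def algebra_simps)
  define q where "q = sqrt 2"
  have q: "q > 1" "q * q = 2" by (simp_all add: q_def)
  have q2: "q * (q * s) = 2 * s" for s
    using q(2) by (simp flip: mult.assoc)
  \<comment> \<open>This is Cauchy-Schwarz for the \<open>G\<close>-norm, written as sums of squares: because
    \<open>(q + 1) (q - 1) = 1\<close>, the numbers \<open>q E - F\<close> and \<open>q E + F\<close> multiplied by \<open>q + 1\<close> are the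
    \<open>G\<close>-forms of \<open>x - (q + 1) z\<close> and \<open>(q + 1) x + z\<close>.\<close>
  have "\<bar>F\<bar> \<le> q * E"
  proof -
    have "(q + 1) * (q * E - F) =
        (1\<^sup>2 * hxx + 2 * 1 * (-(q+1)) * hxz + (-(q+1))\<^sup>2 * hzz) + (1\<^sup>2 * nxx + 2 * 1 * (-(q+1)) * nxz + (-(q+1))\<^sup>2 * nzz)"
      by (simp add: E_def F_def power2_eq_square algebra_simps q(2) q2)
    moreover have "(q + 1) * (q * E + F) =
        ((q+1)\<^sup>2 * hxx + 2 * (q+1) * 1 * hxz + 1\<^sup>2 * hzz) + ((q+1)\<^sup>2 * nxx + 2 * (q+1) * 1 * nxz + 1\<^sup>2 * nzz)"
      by (simp add: E_def F_def power2_eq_square algebra_simps q(2) q2)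
    ultimately have "0 \<le> (q + 1) * (q * E - F)" "0 \<le> (q + 1) * (q * E + F)"
      using h_form n_form by (metis add_nonneg_nonneg)+
    with q(1) have "0 \<le> q * E - F" "0 \<le> q * E + F"
      by (simp_all add: zero_le_mult_iff)
    then show ?thesis by linarith
  qed
  then have "\<bar>r\<bar> * \<bar>F\<bar> \<le> \<bar>r\<bar> * (q * E)"
    by (intro mult_left_mono) auto
  moreover have "\<bar>r\<bar> * \<bar>F\<bar> = E"
    using EF E by (metis abs_mult abs_of_pos)
  ultimately have "1 * E \<le> (q * \<bar>r\<bar>) * E" by (simp add: mult_ac)
  then show "1 \<le> sqrt 2 * \<bar>r\<bar>"
    unfolding q_def using E by (simp add: mult_le_cancel_right)
qed

text \<open>
  With \<open>t = \<eta>\<^sup>1\<^sup>/\<^sup>2\<close>, the substitutions \<open>z = t y\<close> and \<open>N = M / t\<close>, together with division of the second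
  block row by \<open>t\<close>, remove the parameter from the eigenvalue problem.
\<close>

lemma preconditioned_saddle_point_condition_number:
  assumes H: "spd_mat n H" and M: "spd_mat n M" and "n > 0" and \<eta>: "\<eta> > 0"
  defines "P \<equiv> four_block_mat (H + \<eta> powr (-1/2) \<cdot>\<^sub>m M) (0\<^sub>m n n) (0\<^sub>m n n) (\<eta> \<cdot>\<^sub>m H + \<eta> powr (1/2) \<cdot>\<^sub>m M)"
    and "A \<equiv> four_block_mat H M M (- (\<eta> \<cdot>\<^sub>m H))"
  shows "invertible_mat P" "invertible_mat (matrix_inverse P * A)"
    "complex_spectrum (matrix_inverse P * A) \<subseteq> \<real>"
    "condition_number (matrix_inverse P * A) < sqrt 2"
proof -
  note h = spd_matD[OF H] and m = spd_matD[OF M]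
  define t where "t = \<eta> powr (1/2)"
  have t: "t > 0" "t * t = \<eta>" "\<eta> powr (-1/2) = 1 / t"
    using \<eta> by (simp_all add: t_def powr_minus_divide flip: powr_add)
  let ?N = "(1 / t) \<cdot>\<^sub>m M"
  have N: "spd_mat n ?N" using spd_mat_smult[OF M] t by simp
  have P: "spd_mat (n + n) P"
    unfolding P_def t t_def[symmetric] using t \<eta>
    by (intro spd_mat_block_diag spd_mat_add spd_mat_smult H M) auto
  have A: "A \<in> carrier_mat (n + n) (n + n)"
    unfolding A_def using h(1) by simp
  have sym: "transpose_mat A = A"
  proof -
    have "transpose_mat (- (\<eta> \<cdot>\<^sub>m H)) = - (\<eta> \<cdot>\<^sub>m H)"
      using h(1) arg_cong[OF h(2), of "\<lambda>B. - (\<eta> \<cdot>\<^sub>m B)"] by (auto simp: mat_eq_iff)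
    then show ?thesis
      unfolding A_def using h(1,2) m(1,2) by (simp add: transpose_four_block_mat[of _ n n _ n _ n])
  qed
  let ?Z = "matrix_inverse P * A"
  note inv = matrix_inverse_inverts[OF spd_matD(1)[OF P] spd_mat_det_nonzero[OF P]]
  have Z: "?Z \<in> carrier_mat (n + n) (n + n)" using inv(3) A by simp
  have key: "\<exists>r. k = complex_of_real r \<and> 1 \<le> sqrt 2 * \<bar>r\<bar> \<and> \<bar>r\<bar> < 1"
    if k: "k \<in> complex_spectrum ?Z" for k
  proof -
    obtain r v where r: "k = complex_of_real r" and v: "v \<in> carrier_vec (n + n)" "v \<noteq> 0\<^sub>v (n + n)"
      and ev: "A *\<^sub>v v = r \<cdot>\<^sub>v (P *\<^sub>v v)"
      by (rule complex_spectrum_spd_pencil[OF P A sym k])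
    define x y where "x = vec_first v n" and "y = vec_last v n"
    have xy: "v = x @\<^sub>v y" and x: "x \<in> carrier_vec n" and y: "y \<in> carrier_vec n"
      using v(1) by (simp_all add: x_def y_def)
    define z where "z = t \<cdot>\<^sub>v y"
    have z: "z \<in> carrier_vec n" using y by (simp add: z_def)
    have ne: "x \<noteq> 0\<^sub>v n \<or> z \<noteq> 0\<^sub>v n"
    proof (rule ccontr)
      assume "\<not> ?thesis"
      then have "x = 0\<^sub>v n" "z = 0\<^sub>v n" by auto
      moreover from this have "y = 0\<^sub>v n"
        using t(1) y by (auto simp: z_def vec_eq_iff)
      ultimately show False using v(2) xy append_vec_eq_zero_iff[OF x y] by simp
    qed
    have "A *\<^sub>v v = (H *\<^sub>v x + M *\<^sub>v y) @\<^sub>v (M *\<^sub>v x + (- (\<eta> \<cdot>\<^sub>m H)) *\<^sub>v y)"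
      unfolding A_def xy by (rule four_block_mat_mult_vec) (use h(1) m(1) x y in auto)
    moreover have "P *\<^sub>v v = ((H + (1 / t) \<cdot>\<^sub>m M) *\<^sub>v x) @\<^sub>v ((\<eta> \<cdot>\<^sub>m H + t \<cdot>\<^sub>m M) *\<^sub>v y)"
      unfolding P_def xy t t_def[symmetric] by (rule mult_mat_vec_split) (use h(1) m(1) x y in auto)
    moreover have "r \<cdot>\<^sub>v (u @\<^sub>v w) = (r \<cdot>\<^sub>v u) @\<^sub>v (r \<cdot>\<^sub>v w)" for u w
      by (intro eq_vecI) auto
    ultimately have "(H *\<^sub>v x + M *\<^sub>v y) @\<^sub>v (M *\<^sub>v x + (- (\<eta> \<cdot>\<^sub>m H)) *\<^sub>v y) =
      (r \<cdot>\<^sub>v ((H + (1 / t) \<cdot>\<^sub>m M) *\<^sub>v x)) @\<^sub>v (r \<cdot>\<^sub>v ((\<eta> \<cdot>\<^sub>m H + t \<cdot>\<^sub>m M) *\<^sub>v y))"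
      using ev by simp
    moreover have dims: "H *\<^sub>v x + M *\<^sub>v y \<in> carrier_vec n"
      "r \<cdot>\<^sub>v ((H + (1 / t) \<cdot>\<^sub>m M) *\<^sub>v x) \<in> carrier_vec n"
      using h(1) m(1) by (auto intro!: carrier_vecI)
    ultimately have b1: "H *\<^sub>v x + M *\<^sub>v y = r \<cdot>\<^sub>v ((H + (1 / t) \<cdot>\<^sub>m M) *\<^sub>v x)"
      and b2: "M *\<^sub>v x + (- (\<eta> \<cdot>\<^sub>m H)) *\<^sub>v y = r \<cdot>\<^sub>v ((\<eta> \<cdot>\<^sub>m H + t \<cdot>\<^sub>m M) *\<^sub>v y)"
      unfolding append_vec_eq[OF dims] by auto
    have w1: "w \<bullet> (H *\<^sub>v x) + w \<bullet> (M *\<^sub>v y) = r * (w \<bullet> (H *\<^sub>v x) + w \<bullet> (M *\<^sub>v x) / t)"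
      if "w \<in> carrier_vec n" for w
      using arg_cong[OF b1, of "\<lambda>u. w \<bullet> u"] that h(1) m(1) x y
      by (simp add: scalar_prod_add_distrib[of _ n] add_mult_distrib_mat_vec[of _ n n] smult_mat_mult_vec[of _ n n])
    have w2: "w \<bullet> (M *\<^sub>v x) - \<eta> * (w \<bullet> (H *\<^sub>v y)) = r * (\<eta> * (w \<bullet> (H *\<^sub>v y)) + t * (w \<bullet> (M *\<^sub>v y)))"
      if "w \<in> carrier_vec n" for w
      using arg_cong[OF b2, of "\<lambda>u. w \<bullet> u"] that h(1) m(1) x y
      by (simp add: scalar_prod_add_distrib[of _ n] add_mult_distrib_mat_vec[of _ n n] smult_mat_mult_vec[of _ n n])
    have forms: "w \<bullet> (H *\<^sub>v z) = t * (w \<bullet> (H *\<^sub>v y))" "w \<bullet> (?N *\<^sub>v z) = w \<bullet> (M *\<^sub>v y)"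
      "w \<bullet> (?N *\<^sub>v x) = w \<bullet> (M *\<^sub>v x) / t" if "w \<in> carrier_vec n" for w
      using that h(1) m(1) x y t(1)
      by (simp_all add: z_def mult_mat_vec[of _ n n] smult_mat_mult_vec[of _ n n])
    have eq1: "w \<bullet> (H *\<^sub>v x) + w \<bullet> (?N *\<^sub>v z) = r * (w \<bullet> (H *\<^sub>v x) + w \<bullet> (?N *\<^sub>v x))"
      if w: "w \<in> carrier_vec n" for w
      using w1[OF w] by (simp add: forms[OF w])
    have eq2: "w \<bullet> (?N *\<^sub>v x) - w \<bullet> (H *\<^sub>v z) = r * (w \<bullet> (H *\<^sub>v z) + w \<bullet> (?N *\<^sub>v z))"
      if w: "w \<in> carrier_vec n" for w
      using w2[OF w] t(1) unfolding forms[OF w] t(2)[symmetric] by (simp add: field_simps)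
    note saddle_point_eigenvalue_bounds[OF H N x z ne eq1 eq2]
    with r show ?thesis by blast
  qed
  show "invertible_mat P"
    using spd_matD(1)[OF P] spd_mat_det_nonzero[OF P] by (rule invertible_mat_if_det_nonzero)
  show "complex_spectrum ?Z \<subseteq> \<real>"
    using key by force
  have bounds: "1 / sqrt 2 \<le> cmod k \<and> cmod k < 1" if "k \<in> complex_spectrum ?Z" for k
    using key[OF that] by (auto simp: field_simps)
  show "invertible_mat ?Z" "condition_number ?Z < sqrt 2"
    using condition_number_lt[OF Z _ _ bounds] \<open>n > 0\<close> by simp_all
qed

section \<open>Integration of finite element functions\<close>

text \<open>
  The functions take values in an inner product space so that the lemma covers the mass matrix,
  where they are the basis functions, and the stiffness matrix, where they are the gradients.
\<close>

lemma gram_matrix_form: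
  fixes g :: "nat \<Rightarrow> 'b \<Rightarrow> 'a::real_inner"
  assumes int: "\<And>i j. i < n \<Longrightarrow> j < n \<Longrightarrow> set_integrable M S (\<lambda>x. inner (g i x) (g j x))"
    and v: "v \<in> carrier_vec n"
  shows "set_integrable M S (\<lambda>x. (norm (\<Sum>i<n. (v $ i) *\<^sub>R g i x))\<^sup>2)"
    and "v \<bullet> (Matrix.mat n n (\<lambda>(i, j). LINT x:S|M. inner (g i x) (g j x)) *\<^sub>v v) =
      (LINT x:S|M. (norm (\<Sum>i<n. (v $ i) *\<^sub>R g i x))\<^sup>2)"
proof -
  have expand: "(norm (\<Sum>i<n. (v $ i) *\<^sub>R g i x))\<^sup>2 = (\<Sum>i<n. \<Sum>j<n. v $ i * v $ j * inner (g i x) (g j x))" for x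
    by (simp add: power2_norm_eq_inner inner_sum_left inner_sum_right sum_distrib_left mult_ac inner_commute)
  let ?h = "\<lambda>i j x. v $ i * v $ j * (indicat_real S x * inner (g i x) (g j x))"
  have int': "integrable M (?h i j)"
    if "i < n" "j < n" for i j
    using int[OF that] by (simp add: set_integrable_def)
  have ind: "indicat_real S x *\<^sub>R (norm (\<Sum>i<n. (v $ i) *\<^sub>R g i x))\<^sup>2 =
      (\<Sum>i<n. \<Sum>j<n. ?h i j x)" for x
    unfolding expand by (simp add: sum_distrib_left mult_ac)
  show "set_integrable M S (\<lambda>x. (norm (\<Sum>i<n. (v $ i) *\<^sub>R g i x))\<^sup>2)"
    unfolding set_integrable_def ind using int' by (intro Bochner_Integration.integrable_sum) auto
  have "(LINT x:S|M. (norm (\<Sum>i<n. (v $ i) *\<^sub>R g i x))\<^sup>2) =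
      (\<Sum>i<n. \<Sum>j<n. v $ i * v $ j * (LINT x:S|M. inner (g i x) (g j x)))"
  proof -
    have "(LINT x|M. (\<Sum>i<n. \<Sum>j<n. ?h i j x)) = (\<Sum>i<n. LINT x|M. (\<Sum>j<n. ?h i j x))"
      using int' by (intro Bochner_Integration.integral_sum Bochner_Integration.integrable_sum) auto
    also have "\<dots> = (\<Sum>i<n. \<Sum>j<n. LINT x|M. ?h i j x)"
      using int' by (intro sum.cong refl Bochner_Integration.integral_sum) auto
    finally show ?thesis
      unfolding set_lebesgue_integral_def ind by simp
  qed
  also have "\<dots> = v \<bullet> (Matrix.mat n n (\<lambda>(i, j). LINT x:S|M. inner (g i x) (g j x)) *\<^sub>v v)"
    using v by (simp add: scalar_prod_def sum_distrib_left mult_ac atLeast0LessThan)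
  finally show "v \<bullet> (Matrix.mat n n (\<lambda>(i, j). LINT x:S|M. inner (g i x) (g j x)) *\<^sub>v v) =
      (LINT x:S|M. (norm (\<Sum>i<n. (v $ i) *\<^sub>R g i x))\<^sup>2)" ..
qed

text \<open>
  The integrand vanishes almost everywhere on \<open>S\<close>, and the part of \<open>U\<close> where it does not vanish is
  open; an open null set is empty. The set \<open>U\<close> is separate from \<open>S\<close> because gradients jump across
  the edges of the mesh and are continuous only inside the triangles.
\<close>

lemma set_integral_nonneg_eq_0_imp_eq_0:
  fixes g :: "'a::euclidean_space \<Rightarrow> real"
  assumes int: "set_integrable lebesgue S g" and nonneg: "\<And>x. x \<in> S \<Longrightarrow> g x \<ge> 0"
    and zero: "(LINT x:S|lebesgue. g x) = 0"
    and U: "open U" "U \<subseteq> S" "continuous_on U g" and x: "x \<in> U"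
  shows "g x = 0"
proof (rule ccontr)
  assume "g x \<noteq> 0"
  let ?V = "U \<inter> g -` (- {0})"
  have "open ?V"
    using U by (intro continuous_open_preimage) auto
  have "AE y in lebesgue. indicat_real S y *\<^sub>R g y = 0"
    using integral_nonneg_eq_0_iff_AE[of lebesgue "\<lambda>y. indicat_real S y *\<^sub>R g y"] int nonneg zero
    by (auto simp: set_integrable_def set_lebesgue_integral_def indicator_def)
  then obtain N where "negligible N" "{y. indicat_real S y *\<^sub>R g y \<noteq> 0} \<subseteq> N"
    by (auto simp: eventually_ae_filter_negligible)
  moreover from this(2) have "?V \<subseteq> N"
    using U(2) by (auto simp: indicator_def subset_iff)
  ultimately have "negligible ?V"
    using negligible_subset by blast
  with \<open>open ?V\<close> x \<open>g x \<noteq> 0\<close> open_not_negligible[of ?V] show False by auto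
qed

lemma gradient_eqI:
  assumes "open U" "x \<in> U" "\<And>y. y \<in> U \<Longrightarrow> u y = inner a y + b"
  shows "gradient u x = a"
proof -
  have "((\<lambda>y. inner a y + b) has_derivative (\<lambda>h. inner h a)) (at x)"
    by (auto intro!: derivative_eq_intros simp: inner_commute)
  then have D: "GDERIV u x :> a"
    unfolding gderiv_def
    by (rule has_derivative_transform_within_open[OF _ assms(1,2)]) (simp add: assms(3))
  have "D' = a" if "GDERIV u x :> D'" for D'
  proof -
    have "(\<lambda>h. inner h D') = (\<lambda>h. inner h a)"
      using that D unfolding gderiv_def by (rule has_derivative_unique)
    then show ?thesis by (metis vector_eq_ldot)
  qed
  with D show ?thesis unfolding gradient_def by blast
qed

lemma unit_square_facts:
  shows open_unit_square: "open unit_square"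
    and closure_unit_square: "closure unit_square = cbox (0, 0) (1, 1)"
    and interior_closure_unit_square: "interior (closure unit_square) = unit_square"
    and unit_square_nonempty: "unit_square \<noteq> {}"
proof -
  show "open unit_square"
    by (simp add: unit_square_def open_Times)
  show *: "closure unit_square = cbox (0, 0) (1, 1)"
    by (simp add: unit_square_def closure_Times cbox_Pair_eq)
  show "interior (closure unit_square) = unit_square"
    unfolding * by (auto simp: unit_square_def cbox_Pair_eq interior_Times)
  show "unit_square \<noteq> {}"
    by (simp add: unit_square_def)
qed

lemma set_integrable_unit_square:
  fixes f :: "point \<Rightarrow> real"
  assumes "continuous_on (closure unit_square) f"
  shows "set_integrable lebesgue unit_square f"
proof (rule set_integrable_subset)
  show "set_integrable lebesgue (closure unit_square) f"
    using assms unfolding closure_unit_square by (rule absolutely_integrable_continuous)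
qed (auto simp: closure_subset open_unit_square intro: borel_open)

section \<open>Triangulations and the finite element space\<close>

lemma mesh_triangleD:
  assumes tri: "square_triangulation \<T>" and T: "T \<in> \<T>"
  shows "T \<subseteq> closure unit_square" "interior T \<subseteq> unit_square" "interior T \<noteq> {}" "convex T" "compact T"
proof -
  have s: "2 simplex T" and sub: "T \<subseteq> closure unit_square"
    using assms by (auto simp: square_triangulation_def)
  show "T \<subseteq> closure unit_square" by fact
  show "interior T \<subseteq> unit_square"
    using interior_mono[OF sub] by (simp add: interior_closure_unit_square)
  show "convex T" "compact T"
    using s convex_simplex compact_simplex by blast+
  have "aff_dim T = 2" using aff_dim_simplex[OF s] by simp
  then have "affine hull T = UNIV" and "T \<noteq> {}"
    by (auto simp flip: aff_dim_eq_full)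
  then show "interior T \<noteq> {}"
    using rel_interior_interior rel_interior_eq_empty[OF \<open>convex T\<close>] by metis
qed

lemma mesh_nodes_subset:
  assumes "square_triangulation \<T>"
  shows "mesh_nodes \<T> \<subseteq> closure unit_square"
  using mesh_triangleD(1)[OF assms] by (auto simp: mesh_nodes_def extreme_point_of_def)

lemma mesh_nodes_nonempty:
  assumes "square_triangulation \<T>"
  shows "mesh_nodes \<T> \<noteq> {}"
proof -
  have "\<T> \<noteq> {}"
    using assms unit_square_nonempty closure_eq_empty[of unit_square]
    unfolding square_triangulation_def by (metis Union_empty)
  then obtain T where T: "T \<in> \<T>" by blast
  note t = mesh_triangleD[OF assms T]
  have "T \<noteq> {}" using t(3) by auto
  then obtain p where "p extreme_point_of T"
    using extreme_point_exists_convex[OF t(5,4)] by blast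
  with T show ?thesis unfolding mesh_nodes_def by blast
qed

lemma fe_space_gradient:
  assumes "u \<in> fe_space \<T>" "T \<in> \<T>"
  obtains a b where "\<And>x. x \<in> T \<Longrightarrow> u x = inner a x + b" "\<And>x. x \<in> interior T \<Longrightarrow> gradient u x = a"
proof -
  obtain a b where ab: "\<And>x. x \<in> T \<Longrightarrow> u x = inner a x + b"
    using assms by (auto simp: fe_space_def)
  moreover have "gradient u x = a" if "x \<in> interior T" for x
    using gradient_eqI[OF open_interior that] ab interior_subset by blast
  ultimately show thesis using that by blast
qed

text \<open>
  The integrand is constant on the interior of each triangle, and these interiors exhaust the
  square up to the boundaries of the triangles, which form a null set.
\<close>

lemma set_integrable_inner_gradients:
  assumes tri: "square_triangulation \<T>" and u: "u \<in> fe_space \<T>" and w: "w \<in> fe_space \<T>"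
  shows "set_integrable lebesgue unit_square (\<lambda>x. inner (gradient u x) (gradient w x))" (is "set_integrable _ _ ?f")
proof -
  have fin: "finite \<T>" and cover: "\<Union>\<T> = closure unit_square"
    using tri by (auto simp: square_triangulation_def triangulation_def)
  define I where "I = (\<Union>T\<in>\<T>. interior T)"
  have "set_integrable lebesgue (interior T) ?f" if T: "T \<in> \<T>" for T
  proof -
    obtain a where a: "\<And>x. x \<in> interior T \<Longrightarrow> gradient u x = a"
      using fe_space_gradient[OF u T] by blast
    obtain b where b: "\<And>x. x \<in> interior T \<Longrightarrow> gradient w x = b"
      using fe_space_gradient[OF w T] by blast
    have "set_integrable lebesgue (interior T) (\<lambda>x. inner a b)"
      by (rule set_integrable_subset[OF set_integrable_unit_square])
         (use mesh_triangleD(2)[OF tri T] in \<open>auto intro: borel_open\<close>)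
    then show ?thesis
      by (rule set_integrable_cong[THEN iffD1, rotated -1]) (auto simp: a b)
  qed
  then have int_I: "set_integrable lebesgue I ?f"
    unfolding I_def using fin by (intro set_integrable_UN) (auto intro: borel_open)
  have "negligible (\<Union>T\<in>\<T>. frontier T)"
    using fin mesh_triangleD(4)[OF tri] by (auto intro!: negligible_Union negligible_convex_frontier)
  moreover have "unit_square - I \<subseteq> (\<Union>T\<in>\<T>. frontier T)"
  proof
    fix x assume x: "x \<in> unit_square - I"
    then have "x \<in> \<Union>\<T>" using cover closure_subset by blast
    with x show "x \<in> (\<Union>T\<in>\<T>. frontier T)"
      using closure_subset by (fastforce simp: I_def frontier_def)
  qed
  ultimately have N: "negligible (unit_square - I)"
    by (rule negligible_subset)
  moreover have "I - unit_square = {}"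
    using mesh_triangleD(2)[OF tri] by (auto simp: I_def)
  ultimately show ?thesis
    by (intro absolutely_integrable_spike_set[OF int_I]) (auto elim: negligible_subset)
qed

lemma nodal_basisD:
  assumes "nodal_basis \<T> \<phi>" "set ps = mesh_nodes \<T>" "i < length ps"
  shows "\<phi> (ps ! i) \<in> fe_space \<T>"
  using assms by (auto simp: nodal_basis_def dest!: nth_mem)

lemma nodal_combination_eq_0:
  assumes nodal: "nodal_basis \<T> \<phi>" and ps: "distinct ps" "set ps = mesh_nodes \<T>"
    and v: "v \<in> carrier_vec (length ps)"
    and zero: "\<And>x. x \<in> mesh_nodes \<T> \<Longrightarrow> (\<Sum>i<length ps. v $ i * \<phi> (ps ! i) x) = 0"
  shows "v = 0\<^sub>v (length ps)"
proof (rule eq_vecI)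
  fix j assume j: "j < dim_vec (0\<^sub>v (length ps) :: real Matrix.vec)"
  then have j': "j < length ps" by simp
  have "v $ i * \<phi> (ps ! i) (ps ! j) = (if i = j then v $ i else 0)" if "i < length ps" for i
    using nodal ps j' that nth_mem[OF that] nth_mem[OF j']
    by (auto simp: nodal_basis_def nth_eq_iff_index_eq)
  then have "(\<Sum>i<length ps. v $ i * \<phi> (ps ! i) (ps ! j)) = v $ j"
    using j' by simp
  with zero[of "ps ! j"] nth_mem[OF j'] ps(2) j show "v $ j = 0\<^sub>v (length ps) $ j" by simp
qed (use v in simp)

section \<open>Positive definiteness of the finite element matrices\<close>

lemma mass_matrix_spd:
  assumes tri: "square_triangulation \<T>" and nodal: "nodal_basis \<T> \<phi>"
    and ps: "distinct ps" "set ps = mesh_nodes \<T>"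
  shows "spd_mat (length ps) (mass_matrix \<phi> ps)"
proof -
  let ?n = "length ps"
  let ?u = "\<lambda>v x. \<Sum>i<?n. v $ i * \<phi> (ps ! i) x"
  have cont: "continuous_on (closure unit_square) (\<phi> (ps ! i))" if "i < ?n" for i
    using nodal_basisD[OF nodal ps(2) that] by (simp add: fe_space_def)
  have int: "set_integrable lebesgue unit_square (\<lambda>x. inner (\<phi> (ps ! i) x) (\<phi> (ps ! j) x))"
    if "i < ?n" "j < ?n" for i j
    using that by (auto intro!: set_integrable_unit_square continuous_intros cont)
  have M: "mass_matrix \<phi> ps = Matrix.mat ?n ?n (\<lambda>(i, j). LINT x:unit_square|lebesgue. inner (\<phi> (ps ! i) x) (\<phi> (ps ! j) x))"
    by (simp add: mass_matrix_def)
  have "v \<bullet> (mass_matrix \<phi> ps *\<^sub>v v) > 0" if v: "v \<in> carrier_vec ?n" "v \<noteq> 0\<^sub>v ?n" for v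
  proof -
    have form: "v \<bullet> (mass_matrix \<phi> ps *\<^sub>v v) = (LINT x:unit_square|lebesgue. (?u v x)\<^sup>2)"
      and int_u: "set_integrable lebesgue unit_square (\<lambda>x. (?u v x)\<^sup>2)"
      using gram_matrix_form[OF int v(1)] by (simp_all add: M)
    have contu: "continuous_on (closure unit_square) (?u v)"
      by (auto intro!: continuous_intros cont)
    have "(LINT x:unit_square|lebesgue. (?u v x)\<^sup>2) \<noteq> 0"
    proof
      assume 0: "(LINT x:unit_square|lebesgue. (?u v x)\<^sup>2) = 0"
      have "(?u v x)\<^sup>2 = 0" if "x \<in> unit_square" for x
        by (rule set_integral_nonneg_eq_0_imp_eq_0[OF int_u _ 0 open_unit_square subset_refl _ that])
           (auto intro!: continuous_intros continuous_on_subset[OF contu] closure_subset[THEN subsetD])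
      then have "?u v x = 0" if "x \<in> closure unit_square" for x
        using continuous_constant_on_closure[OF contu _ that, of 0] by simp
      then have "v = 0\<^sub>v ?n"
        using nodal_combination_eq_0[OF nodal ps v(1)] mesh_nodes_subset[OF tri] by blast
      with v(2) show False ..
    qed
    moreover have "(LINT x:unit_square|lebesgue. (?u v x)\<^sup>2) \<ge> 0"
      unfolding set_lebesgue_integral_def by (rule Bochner_Integration.integral_nonneg) simp
    ultimately show ?thesis by (simp add: form)
  qed
  then show ?thesis
    by (auto simp: spd_mat_def M mat_eq_iff mult.commute)
qed

text \<open>
  The function takes finitely many values, at most one for each triangle. A continuous function
  with finitely many values on a connected set is constant.
\<close>

lemma fe_constant_if_constant_on_triangles:
  assumes tri: "square_triangulation \<T>"
    and cont: "continuous_on (closure unit_square) u"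
    and const: "\<And>T. T \<in> \<T> \<Longrightarrow> \<exists>c::real. \<forall>x\<in>T. u x = c"
  obtains c where "\<And>x. x \<in> closure unit_square \<Longrightarrow> u x = c"
proof -
  obtain c where c: "\<And>T x. T \<in> \<T> \<Longrightarrow> x \<in> T \<Longrightarrow> u x = c T"
    using const by metis
  have "closure unit_square = \<Union>\<T>" "finite \<T>"
    using tri by (auto simp: square_triangulation_def triangulation_def)
  moreover from this c have "u ` closure unit_square \<subseteq> c ` \<T>"
    by fastforce
  ultimately have "finite (u ` closure unit_square)"
    using finite_subset by blast
  moreover have "connected (closure unit_square)"
    unfolding closure_unit_square by (simp add: convex_connected)
  ultimately have "u constant_on closure unit_square"
    using cont continuous_finite_range_constant by blast
  then show thesis using that by (auto simp: constant_on_def)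
qed

lemma outer_square_form:
  assumes "m \<in> carrier_vec n" "v \<in> carrier_vec n"
  shows "v \<bullet> (outer_square m *\<^sub>v v) = (m \<bullet> v)\<^sup>2"
    and "outer_square m \<in> carrier_mat n n" "transpose_mat (outer_square m) = outer_square m"
proof -
  have entry: "outer_square m = Matrix.mat n n (\<lambda>(i, j). m $ i * m $ j)"
    using assms(1)
    by (auto intro!: eq_matI simp: outer_square_def mat_of_cols_def mat_of_rows_def scalar_prod_def)
  show "outer_square m \<in> carrier_mat n n" "transpose_mat (outer_square m) = outer_square m"
    by (auto simp: entry mat_eq_iff)
  show "v \<bullet> (outer_square m *\<^sub>v v) = (m \<bullet> v)\<^sup>2"
    using assms
    by (simp add: entry scalar_prod_def power2_eq_square sum_product sum_distrib_left mult_ac)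
qed

text \<open>
  Constants span the kernel of the stiffness matrix; they do not have mean zero, so the
  square of the mean makes the form definite.
\<close>

lemma stiffness_matrix_plus_mean_spd:
  assumes tri: "square_triangulation \<T>" and nodal: "nodal_basis \<T> \<phi>"
    and ps: "distinct ps" "set ps = mesh_nodes \<T>"
  shows "spd_mat (length ps) (stiffness_matrix \<phi> ps + outer_square (mean_vector \<phi> ps))"
proof -
  let ?n = "length ps"
  let ?K = "stiffness_matrix \<phi> ps"
  let ?m = "mean_vector \<phi> ps"
  let ?u = "\<lambda>v x. \<Sum>i<?n. v $ i * \<phi> (ps ! i) x"
  let ?Du = "\<lambda>v x. \<Sum>i<?n. (v $ i) *\<^sub>R gradient (\<phi> (ps ! i)) x"
  note fe = nodal_basisD[OF nodal ps(2)]
  have cont: "continuous_on (closure unit_square) (\<phi> (ps ! i))" if "i < ?n" for i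
    using fe[OF that] by (simp add: fe_space_def)
  have int: "set_integrable lebesgue unit_square (\<lambda>x. inner (gradient (\<phi> (ps ! i)) x) (gradient (\<phi> (ps ! j)) x))"
    if "i < ?n" "j < ?n" for i j
    by (rule set_integrable_inner_gradients[OF tri fe[OF that(1)] fe[OF that(2)]])
  have K: "?K \<in> carrier_mat ?n ?n" "transpose_mat ?K = ?K"
    by (auto simp: stiffness_matrix_def mat_eq_iff inner_commute)
  have m: "?m \<in> carrier_vec ?n"
    by (simp add: mean_vector_def)
  have "v \<bullet> ((?K + outer_square ?m) *\<^sub>v v) > 0" if v: "v \<in> carrier_vec ?n" "v \<noteq> 0\<^sub>v ?n" for v
  proof -
    have form: "v \<bullet> (?K *\<^sub>v v) = (LINT x:unit_square|lebesgue. (norm (?Du v x))\<^sup>2)"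
      and int_Du: "set_integrable lebesgue unit_square (\<lambda>x. (norm (?Du v x))\<^sup>2)"
      using gram_matrix_form[OF int v(1)] by (simp_all add: stiffness_matrix_def)
    have nonneg: "v \<bullet> (?K *\<^sub>v v) \<ge> 0"
      unfolding form set_lebesgue_integral_def by (rule Bochner_Integration.integral_nonneg) simp
    have total: "v \<bullet> ((?K + outer_square ?m) *\<^sub>v v) = v \<bullet> (?K *\<^sub>v v) + (?m \<bullet> v)\<^sup>2"
      using K(1) outer_square_form[OF m v(1)] v(1)
      by (simp add: add_mult_distrib_mat_vec[of _ ?n ?n] scalar_prod_add_distrib[of _ ?n])
    have mean: "?m \<bullet> v = (LINT x:unit_square|lebesgue. ?u v x)"
    proof -
      have "set_integrable lebesgue unit_square (\<phi> (ps ! i))" if "i < ?n" for i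
        using cont[OF that] by (rule set_integrable_unit_square)
      then have "integrable lebesgue (\<lambda>x. v $ i * (indicat_real unit_square x * \<phi> (ps ! i) x))" if "i < ?n" for i
        using that by (simp add: set_integrable_def)
      then have "(LINT x|lebesgue. (\<Sum>i<?n. v $ i * (indicat_real unit_square x * \<phi> (ps ! i) x))) =
          (\<Sum>i<?n. LINT x|lebesgue. v $ i * (indicat_real unit_square x * \<phi> (ps ! i) x))"
        by (intro Bochner_Integration.integral_sum) auto
      moreover have "indicat_real unit_square x *\<^sub>R ?u v x =
          (\<Sum>i<?n. v $ i * (indicat_real unit_square x * \<phi> (ps ! i) x))" for x
        by (simp only: real_scaleR_def sum_distrib_left mult.left_commute)
      ultimately have "(LINT x:unit_square|lebesgue. ?u v x) = (\<Sum>i<?n. v $ i * (LINT x:unit_square|lebesgue. \<phi> (ps ! i) x))"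
        unfolding set_lebesgue_integral_def by simp
      then show ?thesis
        using v(1) by (simp add: mean_vector_def scalar_prod_def mult.commute atLeast0LessThan)
    qed
    have "v = 0\<^sub>v ?n" if K0: "v \<bullet> (?K *\<^sub>v v) = 0" and m0: "?m \<bullet> v = 0"
    proof -
      have "\<exists>c. \<forall>x\<in>T. ?u v x = c" if T: "T \<in> \<T>" for T
      proof -
        have "\<forall>i<?n. \<exists>a b. (\<forall>x\<in>T. \<phi> (ps ! i) x = inner a x + b) \<and> (\<forall>x\<in>interior T. gradient (\<phi> (ps ! i)) x = a)"
          using fe_space_gradient[OF fe T] by metis
        then obtain a b where u: "\<And>i x. i < ?n \<Longrightarrow> x \<in> T \<Longrightarrow> \<phi> (ps ! i) x = inner (a i) x + b i"
          and Du: "\<And>i x. i < ?n \<Longrightarrow> x \<in> interior T \<Longrightarrow> gradient (\<phi> (ps ! i)) x = a i"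
          by metis
        define A where "A = (\<Sum>i<?n. (v $ i) *\<^sub>R a i)"
        have grad: "?Du v x = A" if "x \<in> interior T" for x
          using Du[OF _ that] by (simp add: A_def)
        obtain x where x: "x \<in> interior T"
          using mesh_triangleD(3)[OF tri T] by blast
        have "continuous_on (interior T) (\<lambda>x. (norm (?Du v x))\<^sup>2)"
          by (rule continuous_on_eq[of _ "\<lambda>x. (norm A)\<^sup>2"]) (auto simp: grad)
        then have "(norm (?Du v x))\<^sup>2 = 0"
          using set_integral_nonneg_eq_0_imp_eq_0[OF int_Du _ _ open_interior mesh_triangleD(2)[OF tri T] _ x] K0 form
          by simp
        then have "A = 0" by (simp add: grad[OF x])
        have "?u v x = (\<Sum>i<?n. v $ i * b i)" if "x \<in> T" for x
        proof -
          have "?u v x = inner A x + (\<Sum>i<?n. v $ i * b i)"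
            using that by (simp add: u A_def inner_sum_left sum.distrib distrib_left)
          with \<open>A = 0\<close> show ?thesis by simp
        qed
        then show ?thesis by blast
      qed
      moreover have "continuous_on (closure unit_square) (?u v)"
        by (auto intro!: continuous_intros cont)
      ultimately obtain c where c: "\<And>x. x \<in> closure unit_square \<Longrightarrow> ?u v x = c"
        using fe_constant_if_constant_on_triangles[OF tri] by blast
      \<comment> \<open>Multiplying by the constant turns the vanishing mean into the vanishing integral of a
        nonnegative function.\<close>
      have "(LINT x:unit_square|lebesgue. ?u v x) = (LINT x:unit_square|lebesgue. c)"
        by (rule set_lebesgue_integral_cong) (use c closure_subset open_unit_square in \<open>auto intro: borel_open\<close>)
      then have "(LINT x:unit_square|lebesgue. c * c) = 0"
        using mean m0 by simp
      moreover have "set_integrable lebesgue unit_square (\<lambda>x. c * c)"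
        by (rule set_integrable_unit_square) auto
      ultimately have "c * c = 0"
        using set_integral_nonneg_eq_0_imp_eq_0[of unit_square "\<lambda>x. c * c", OF _ _ _ open_unit_square subset_refl] unit_square_nonempty
        by auto
      then have "?u v x = 0" if "x \<in> closure unit_square" for x
        using c[OF that] by simp
      then show ?thesis
        using nodal_combination_eq_0[OF nodal ps v(1)] mesh_nodes_subset[OF tri] by blast
    qed
    with v(2) nonneg show ?thesis
      unfolding total by (metis add_nonneg_pos add_pos_nonneg order_le_less zero_le_power2 zero_less_power2)
  qed
  moreover have "transpose_mat (?K + outer_square ?m) = ?K + outer_square ?m"
    using K outer_square_form(2,3)[OF m m] by (simp add: transpose_add[of _ ?n ?n])
  ultimately show ?thesis
    using K(1) outer_square_form(2)[OF m m] by (auto simp: spd_mat_def)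
qed

theorem corollary5p1:
  fixes \<T> :: "point set set" and \<phi> :: "point \<Rightarrow> point \<Rightarrow> real" and ps :: "point list" and \<eta> :: real
  assumes "square_triangulation \<T>"
    and "distinct ps" and "set ps = mesh_nodes \<T>"
    and "nodal_basis \<T> \<phi>"
    and "\<eta> > 0"
  shows "let n = length ps;
             M = mass_matrix \<phi> ps;
             K = stiffness_matrix \<phi> ps;
             m = mean_vector \<phi> ps;
             Kb = K + outer_square m;
             P = four_block_mat (Kb + \<eta> powr (-1/2) \<cdot>\<^sub>m M) (0\<^sub>m n n)
                                (0\<^sub>m n n) (\<eta> \<cdot>\<^sub>m Kb + \<eta> powr (1/2) \<cdot>\<^sub>m M);
             A = four_block_mat Kb M
                                M (- (\<eta> \<cdot>\<^sub>m Kb));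
             Z = matrix_inverse P * A
         in invertible_mat P \<and> invertible_mat Z \<and> complex_spectrum Z \<subseteq> \<real> \<and>
            condition_number Z < sqrt 2"
proof -
  have "length ps > 0"
    using mesh_nodes_nonempty[OF assms(1)] assms(3) by auto
  from preconditioned_saddle_point_condition_number
    [OF stiffness_matrix_plus_mean_spd[OF assms(1,4,2,3)] mass_matrix_spd[OF assms(1,4,2,3)] this assms(5)]
  show ?thesis unfolding Let_def by blast
qed

end
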